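(* Let $p\in\{0,1\}$ and let the scalar complex-valued functions $\rho,v_1,v_2$ on $D$ be such that, with $R=\rho I_2$ and $V=\begin{bmatrix}0&v_1\\ v_2&0\end{bmatrix}$, $V_t$ is continuous in $(x,t)$ jointly and $$R_x=\frac{(-1)^p}2(VV_t+V_tV),\qquad V_{tx}=\frac12(VR+RV)\quad\text{in } D.$$ Let $n\in\mathbb N$, let $A_1,A_2,S(0,0)$ be invertible complex $n\times n$ matrices and $\Pi_1(0,0),\Pi_2(0,0)$ complex $n\times2$ matrices such that $$A_1S(0,0)-S(0,0)A_2=\Pi_1(0,0)\Pi_2(0,0)^*,$$ and let $\Pi_1(x,t),\Pi_2(x,t),S(x,t)$ be determined by these initial values and the linear systems of the context. Then, at the points of $D$ where $S(x,t)$ is invertible, the functions $\widetilde v_1,\widetilde v_2$ given by $$\begin{bmatrix}0&\widetilde v_1\\ \widetilde v_2&0\end{bmatrix}=V+\frac12j^p(X_0-jX_0j)$$ and $$\widetilde\rho=\mathrm i\begin{bmatrix}0&1\end{bmatrix}\widetilde Q_{-1}\begin{bmatrix}0\\1\end{bmatrix}$$ satisfy $$\widetilde\rho_x=\frac{(-1)^p}2\big(\widetilde v_1(\widetilde v_2)_t+(\widetilde v_1)_t\widetilde v_2\big),\qquad(\widetilde v_1)_{tx}=\widetilde\rho\,\widetilde v_1,\qquad(\widetilde v_2)_{tx}=\widetilde\rho\,\widetilde v_2.$$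
   Context: Notation. $j=\begin{bmatrix}1&0\\0&-1\end{bmatrix}$; subscripts $x,t$ denote partial derivatives; $^*$ is the conjugate transpose. The domain is $D=\{(x,t):\ a_1<x<a_2,\ b_1<t<b_2\}$ with $-\infty\le a_1<0<a_2\le\infty$, $-\infty\le b_1<0<b_2\le\infty$. Coefficients: $q_1=-\frac{\mathrm i}4j$, $q_0=\frac{\mathrm i}2j^{p+1}V$, $Q_{-1}=\mathrm i jR-j^pV_t$. Linear systems: $(\Pi_1)_x=\Pi_1q_0+A_1\Pi_1q_1$, $(\Pi_1)_t=A_1^{-1}\Pi_1Q_{-1}$; $(\Pi_2)_x=-\Pi_2q_0^*-A_2^*\Pi_2q_1^*$, $(\Pi_2)_t=-(A_2^* )^{-1}\Pi_2Q_{-1}^*$; $S_x=\Pi_1q_1\Pi_2^*$, $S_t=-A_1^{-1}\Pi_1Q_{-1}\Pi_2^*A_2^{-1}$. At points where $S$ is invertible: $X_0=\Pi_2^*S^{-1}\Pi_1$, $X_{-1}=\Pi_2^*S^{-1}A_1^{-1}\Pi_1$, $Y_{-1}=\Pi_2^*A_2^{-1}S^{-1}\Pi_1$, $\widetilde Q_{-1}=(I_2-X_{-1})Q_{-1}(I_2+Y_{-1})$. *)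

theory Defs
  imports "HOL-Analysis.Analysis"
begin

definition cscale :: "complex \<Rightarrow> complex^'m^'n \<Rightarrow> complex^'m^'n"  (infixr "\<cdot>\<^sub>C" 75)
  where "c \<cdot>\<^sub>C A = map_matrix ((*) c) A"

definition ctranspose :: "complex^'m^'n \<Rightarrow> complex^'n^'m"
  where "ctranspose A = map_matrix cnj (transpose A)"

text \<open>The type class power \<open>A ^ k\<close> on vectors is componentwise, so the power with
  respect to \<open>**\<close> is introduced separately.\<close>

primrec mpow :: "complex^'n^'n \<Rightarrow> nat \<Rightarrow> complex^'n^'n"
  where
    "mpow A 0 = mat 1"
  | "mpow A (Suc k) = A ** mpow A k"

definition j :: "complex^2^2"
  where "j = vector [vector [1, 0], vector [0, -1]]"

definition antidiag :: "complex \<Rightarrow> complex \<Rightarrow> complex^2^2"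
  where "antidiag a b = vector [vector [0, a], vector [b, 0]]"

definition rectangle :: "ereal \<Rightarrow> ereal \<Rightarrow> ereal \<Rightarrow> ereal \<Rightarrow> (real \<times> real) set"
  where "rectangle a1 a2 b1 b2 =
    {(x, t). a1 < ereal x \<and> ereal x < a2 \<and> b1 < ereal t \<and> ereal t < b2}"

text \<open>\<open>has_dx F F' x t\<close> states that the partial derivative \<open>F\<^sub>x\<close> exists at \<open>(x, t)\<close> and
  equals \<open>F'\<close>; similarly for \<open>has_dt\<close>. The function \<open>dt F\<close> is \<open>F\<^sub>t\<close> and is meaningful only
  where \<open>F x\<close> is differentiable.\<close>

definition has_dx ::
    "(real \<Rightarrow> real \<Rightarrow> 'a::real_normed_vector) \<Rightarrow> 'a \<Rightarrow> real \<Rightarrow> real \<Rightarrow> bool"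
  where "has_dx F F' x t \<longleftrightarrow> ((\<lambda>\<xi>. F \<xi> t) has_vector_derivative F') (at x)"

definition has_dt ::
    "(real \<Rightarrow> real \<Rightarrow> 'a::real_normed_vector) \<Rightarrow> 'a \<Rightarrow> real \<Rightarrow> real \<Rightarrow> bool"
  where "has_dt F F' x t \<longleftrightarrow> ((\<lambda>\<tau>. F x \<tau>) has_vector_derivative F') (at t)"

definition dt ::
    "(real \<Rightarrow> real \<Rightarrow> 'a::real_normed_vector) \<Rightarrow> real \<Rightarrow> real \<Rightarrow> 'a"
  where "dt F x t = vector_derivative (\<lambda>\<tau>. F x \<tau>) (at t)"

definition q1 :: "complex^2^2"
  where "q1 = (- \<i> / 4) \<cdot>\<^sub>C j"

definition q0 :: "nat \<Rightarrow> (real \<Rightarrow> real \<Rightarrow> complex^2^2) \<Rightarrow> real \<Rightarrow> real \<Rightarrow> complex^2^2"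
  where "q0 p V x t = (\<i> / 2) \<cdot>\<^sub>C (mpow j (p + 1) ** V x t)"

definition Qm1 ::
    "nat \<Rightarrow> (real \<Rightarrow> real \<Rightarrow> complex^2^2) \<Rightarrow> (real \<Rightarrow> real \<Rightarrow> complex^2^2)
      \<Rightarrow> real \<Rightarrow> real \<Rightarrow> complex^2^2"
  where "Qm1 p R V x t = \<i> \<cdot>\<^sub>C (j ** R x t) - mpow j p ** dt V x t"

definition linear_systems ::
    "(real \<times> real) set \<Rightarrow> nat
      \<Rightarrow> (real \<Rightarrow> real \<Rightarrow> complex^2^2) \<Rightarrow> (real \<Rightarrow> real \<Rightarrow> complex^2^2)
      \<Rightarrow> complex^'n^'n \<Rightarrow> complex^'n^'n
      \<Rightarrow> (real \<Rightarrow> real \<Rightarrow> complex^2^'n) \<Rightarrow> (real \<Rightarrow> real \<Rightarrow> complex^2^'n)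
      \<Rightarrow> (real \<Rightarrow> real \<Rightarrow> complex^'n^'n) \<Rightarrow> bool"
  where "linear_systems D p R V A1 A2 \<Pi>1 \<Pi>2 S \<longleftrightarrow>
    (\<forall>(x, t) \<in> D.
      has_dx \<Pi>1 (\<Pi>1 x t ** q0 p V x t + A1 ** \<Pi>1 x t ** q1) x t \<and>
      has_dt \<Pi>1 (matrix_inv A1 ** \<Pi>1 x t ** Qm1 p R V x t) x t \<and>
      has_dx \<Pi>2 (- (\<Pi>2 x t ** ctranspose (q0 p V x t))
                  - ctranspose A2 ** \<Pi>2 x t ** ctranspose q1) x t \<and>
      has_dt \<Pi>2 (- (matrix_inv (ctranspose A2) ** \<Pi>2 x t ** ctranspose (Qm1 p R V x t))) x t \<and>
      has_dx S (\<Pi>1 x t ** q1 ** ctranspose (\<Pi>2 x t)) x t \<and>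
      has_dt S (- (matrix_inv A1 ** \<Pi>1 x t ** Qm1 p R V x t ** ctranspose (\<Pi>2 x t)
                    ** matrix_inv A2)) x t)"

text \<open>In the following the arguments \<open>P1\<close>, \<open>P2\<close>, \<open>S\<close> are the values of
  \<open>\<Pi>\<^sub>1\<close>, \<open>\<Pi>\<^sub>2\<close>, \<open>S\<close> at a point where \<open>S\<close> is invertible.\<close>

definition X0 :: "complex^2^'n \<Rightarrow> complex^2^'n \<Rightarrow> complex^'n^'n \<Rightarrow> complex^2^2"
  where "X0 P1 P2 S = ctranspose P2 ** matrix_inv S ** P1"

definition Xm1 ::
    "complex^'n^'n \<Rightarrow> complex^2^'n \<Rightarrow> complex^2^'n \<Rightarrow> complex^'n^'n \<Rightarrow> complex^2^2"
  where "Xm1 A1 P1 P2 S = ctranspose P2 ** matrix_inv S ** matrix_inv A1 ** P1"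

definition Ym1 ::
    "complex^'n^'n \<Rightarrow> complex^2^'n \<Rightarrow> complex^2^'n \<Rightarrow> complex^'n^'n \<Rightarrow> complex^2^2"
  where "Ym1 A2 P1 P2 S = ctranspose P2 ** matrix_inv A2 ** matrix_inv S ** P1"

definition Qtilde ::
    "complex^'n^'n \<Rightarrow> complex^'n^'n \<Rightarrow> complex^2^'n \<Rightarrow> complex^2^'n \<Rightarrow> complex^'n^'n
      \<Rightarrow> complex^2^2 \<Rightarrow> complex^2^2"
  where "Qtilde A1 A2 P1 P2 S Q =
    (mat 1 - Xm1 A1 P1 P2 S) ** Q ** (mat 1 + Ym1 A2 P1 P2 S)"

definition Vtilde :: "nat \<Rightarrow> complex^2^2 \<Rightarrow> complex^2^2 \<Rightarrow> complex^2^2"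
  where "Vtilde p V X = V + (1/2) \<cdot>\<^sub>C (mpow j p ** (X - j ** X ** j))"

text \<open>The transformed potential always has zero diagonal, so requiring it to be of the form
  \<open>antidiag v1 v2\<close> merely names its two other entries.\<close>

lemma Vtilde_antidiag:
  assumes "p \<in> {0, 1}"
  shows "\<exists>!w. antidiag (fst w) (snd w) = Vtilde p (antidiag v1 v2) X"
proof -
  have "mpow j p = mat 1 \<or> mpow j p = j"
    using assms by auto
  then have "antidiag (Vtilde p (antidiag v1 v2) X $ 1 $ 2) (Vtilde p (antidiag v1 v2) X $ 2 $ 1)
      = Vtilde p (antidiag v1 v2) X"
    by (auto simp: Vtilde_def antidiag_def cscale_def j_def vec_eq_iff forall_2
        matrix_matrix_mult_def sum_2 mat_def)
  moreover have "a = a' \<and> b = b'" if "antidiag a b = antidiag a' b'" for a b a' b'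
    using that by (auto simp: antidiag_def vec_eq_iff forall_2)
  ultimately show ?thesis
    by (metis prod.collapse fst_conv snd_conv)
qed

end

theory Submission
  imports Defs
begin

text \<open>
  Write \<open>W\<close> for \<open>\<Pi>\<^sub>2\<^sup>*\<close>, \<open>q\<close> for \<open>q\<^sub>0\<close>, \<open>Q\<close> for \<open>Q\<^sub>-\<^sub>1\<close> and \<open>[A, B]\<close> for \<open>A B - B A\<close>. The seed equations
  say precisely that \<open>Q\<close> satisfies the Lax equation \<open>Q\<^sub>x = [Q, q]\<close>, where \<open>Q\<close> is traceless with
  diagonal part \<open>\<i> \<rho> j\<close> and off-diagonal part \<open>- j\<^sup>p V\<^sub>t\<close>, and \<open>q = (\<i>/2) j\<^sup>p\<^sup>+\<^sup>1 V\<close>. It therefore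
  suffices to show that the transformed objects satisfy an equation of the same shape, and then
  to read off its entries. Both uses of this equivalence rest on the single identity
  \<open>lax_commutator\<close>.

  The transformed equation is obtained by conjugation. The linear systems preserve the matrix
  identity \<open>A\<^sub>1 S - S A\<^sub>2 = \<Pi>\<^sub>1 W\<close> (\<open>sylvester_residual_x\<close>, \<open>sylvester_residual_t\<close>). Because of it,
  \<open>T = I - X\<^sub>-\<^sub>1\<close> has the inverse \<open>Z = I + Y\<^sub>-\<^sub>1\<close> (\<open>darboux_matrix_inverse\<close>), so \<open>T Q Z\<close>, which is
  the matrix called \<open>Q~\<close>, is similar to \<open>Q\<close> and still traceless; and \<open>T\<close> is a gauge
  transformation, \<open>T\<^sub>x = T q - q~ T\<close> with \<open>q~ = q - [q\<^sub>1, X\<^sub>0]\<close> (\<open>darboux_matrix_x\<close>,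
  \<open>darboux_matrix_inverse_x\<close>). Hence \<open>Q~\<^sub>x = [Q~, q~]\<close> (\<open>lax_equation_conjugate\<close>).

  It remains to identify \<open>Q~\<close> and \<open>q~\<close> with the matrices built from the new functions. The
  definition of the new potential gives \<open>q~ = (\<i>/2) j\<^sup>p\<^sup>+\<^sup>1 V~\<close> at once (\<open>lax_x_Vtilde\<close>). The
  off-diagonal part of \<open>Q~\<close> is \<open>- j\<^sup>p V~\<^sub>t\<close>, because \<open>(X\<^sub>0)\<^sub>t = Q - Q~\<close> (\<open>X0_t\<close>), and its diagonal part
  is \<open>\<i> \<rho>~ j\<close> because its trace vanishes and \<open>\<rho>~\<close> was defined by its last entry.

  All derivatives are taken along horizontal or vertical lines, so the calculus below is that
  of matrix functions of one real variable.
\<close>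

section \<open>Matrix functions of one real variable\<close>

lemma bounded_bilinear_matrix_mult:
  "bounded_bilinear ((**) :: complex^'m^'n \<Rightarrow> complex^'k^'m \<Rightarrow> complex^'k^'n)"
  unfolding bilinear_conv_bounded_bilinear[symmetric] bilinear_def
  by (auto intro!: linearI simp: matrix_matrix_mult_def vec_eq_iff distrib_left distrib_right
      sum.distrib scaleR_sum_right)

lemma bounded_linear_ctranspose:
  "bounded_linear (ctranspose :: complex^'m^'n \<Rightarrow> complex^'n^'m)"
  unfolding linear_conv_bounded_linear[symmetric]
  by (auto intro!: linearI simp: ctranspose_def vec_eq_iff transpose_def)

lemma bounded_linear_cscale:
  "bounded_linear (\<lambda>A :: complex^'m^'n. c \<cdot>\<^sub>C A)"
  unfolding linear_conv_bounded_linear[symmetric]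
  by (auto intro!: linearI simp: cscale_def vec_eq_iff distrib_left)

interpretation matrix_mult: bounded_bilinear
  "(**) :: complex^'m^'n \<Rightarrow> complex^'k^'m \<Rightarrow> complex^'k^'n"
  by (rule bounded_bilinear_matrix_mult)

lemma ctranspose_ctranspose: "ctranspose (ctranspose A) = A"
  by (simp add: ctranspose_def vec_eq_iff transpose_def)

lemma ctranspose_minus: "ctranspose (- A) = - ctranspose A"
  by (simp add: ctranspose_def vec_eq_iff transpose_def)

lemma ctranspose_diff: "ctranspose (A - B) = ctranspose A - ctranspose B"
  by (simp add: ctranspose_def vec_eq_iff transpose_def)

lemma ctranspose_mult: "ctranspose (A ** B) = ctranspose B ** ctranspose A"
  by (simp add: ctranspose_def vec_eq_iff transpose_def matrix_matrix_mult_def mult.commute)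

lemma matrix_inv_right_left:
  fixes A :: "complex^'n^'n"
  assumes "invertible A"
  shows "A ** matrix_inv A = mat 1" "matrix_inv A ** A = mat 1"
proof -
  have "\<exists>B. A ** B = mat 1 \<and> B ** A = mat 1"
    using assms by (auto simp: invertible_def)
  then have "A ** matrix_inv A = mat 1 \<and> matrix_inv A ** A = mat 1"
    unfolding matrix_inv_def by (rule someI_ex)
  then show "A ** matrix_inv A = mat 1" "matrix_inv A ** A = mat 1"
    by auto
qed

lemma matrix_inv_unique:
  fixes A :: "complex^'n^'n"
  assumes "A ** B = mat 1"
  shows "invertible A" "matrix_inv A = B"
proof -
  show inv: "invertible A"
    using assms matrix_left_right_inverse unfolding invertible_def by blast
  have "matrix_inv A = matrix_inv A ** (A ** B)"
    by (simp add: assms)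
  then show "matrix_inv A = B"
    by (simp add: matrix_mul_assoc matrix_inv_right_left[OF inv])
qed

lemma matrix_inv_ctranspose:
  fixes A :: "complex^'n^'n"
  assumes "invertible A"
  shows "matrix_inv (ctranspose A) = ctranspose (matrix_inv A)"
proof (rule matrix_inv_unique)
  have "ctranspose (matrix_inv A ** A) = mat 1"
    by (simp only: matrix_inv_right_left(2)[OF assms])
      (simp add: ctranspose_def vec_eq_iff mat_def transpose_def)
  then show "ctranspose A ** ctranspose (matrix_inv A) = mat 1"
    by (simp add: ctranspose_mult)
qed

lemma differentiable_vec_nth:
  fixes f :: "real \<Rightarrow> 'a::euclidean_space ^ 'n"
  assumes "f differentiable (at t)"
  shows "(\<lambda>s. f s $ i) differentiable (at t)"
  using assms bounded_linear.has_derivative[OF bounded_linear_vec_nth]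
  unfolding differentiable_def by blast

lemma differentiable_vec_componentwise:
  fixes f :: "real \<Rightarrow> 'a::euclidean_space ^ 'n"
  assumes "\<And>i. (\<lambda>s. f s $ i) differentiable (at t)"
  shows "f differentiable (at t)"
  unfolding differentiable_componentwise_within[of f]
proof
  fix b :: "'a ^ 'n" assume "b \<in> Basis"
  then obtain i u where "b = axis i u" by (auto simp: Basis_vec_def)
  moreover have "(\<lambda>s. f s $ i \<bullet> u) differentiable (at t)"
    using assms[of i] by (intro differentiable_inner) auto
  ultimately show "(\<lambda>s. f s \<bullet> b) differentiable (at t)"
    by (simp add: inner_axis)
qed

lemma differentiable_det:
  fixes F :: "real \<Rightarrow> complex^'n^'n"
  assumes "F differentiable (at t)"
  shows "(\<lambda>s. det (F s)) differentiable (at t)"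
proof -
  have "\<exists>F'. \<forall>i k. ((\<lambda>s. F s $ i $ k) has_derivative F' i k) (at t)"
    using differentiable_vec_nth[OF differentiable_vec_nth[OF assms]]
    unfolding differentiable_def by (intro choice allI)
  then obtain F' where "\<And>i k. ((\<lambda>s. F s $ i $ k) has_derivative F' i k) (at t)"
    by metis
  then have "((\<lambda>s. \<Prod>i\<in>UNIV. F s $ i $ \<pi> i) has_derivative
      (\<lambda>h. \<Sum>i\<in>UNIV. F' i (\<pi> i) h * (\<Prod>l\<in>UNIV - {i}. F t $ l $ \<pi> l))) (at t)" for \<pi>
    by (intro has_derivative_prod)
  then have "(\<lambda>s. \<Prod>i\<in>UNIV. F s $ i $ \<pi> i) differentiable (at t)" for \<pi>
    unfolding differentiable_def by blast
  then show ?thesis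
    unfolding det_def
    by (intro differentiable_sum differentiable_mult differentiable_const)
      (auto simp: finite_permutations)
qed

text \<open>
  Invertibility at one point of a line persists nearby; this is what makes it meaningful to
  differentiate the transformed functions, which are prescribed only where \<open>S\<close> is invertible.
\<close>

lemma eventually_invertible:
  fixes F :: "real \<Rightarrow> complex^'n^'n"
  assumes "F differentiable (at t)" and "invertible (F t)"
  shows "\<forall>\<^sub>F s in nhds t. invertible (F s)"
proof -
  have "isCont (\<lambda>s. det (F s)) t"
    by (intro differentiable_imp_continuous_within differentiable_det assms)
  moreover have "det (F t) \<noteq> 0"
    using assms by (simp add: invertible_det_nz)
  ultimately have "\<forall>\<^sub>F s in nhds t. det (F s) \<noteq> 0"
    unfolding continuous_at tendsto_at_iff_tendsto_nhds[where g = "\<lambda>s. det (F s)"]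
    by (rule tendsto_imp_eventually_ne)
  then show ?thesis
    by (simp add: invertible_det_nz)
qed

lemma has_vector_derivative_eventually_const:
  fixes f :: "real \<Rightarrow> 'a::real_normed_vector"
  assumes "(f has_vector_derivative f') (at t)" and "\<forall>\<^sub>F s in nhds t. f s = c"
  shows "f' = 0"
proof -
  have "((\<lambda>s. c) has_vector_derivative f') (at t)"
    using assms eventually_nhds_x_imp_x[OF assms(2)]
    by (subst has_vector_derivative_cong_ev[where g = f]) (auto elim: eventually_mono)
  then show ?thesis
    using has_vector_derivative_const vector_derivative_unique_at by blast
qed

text \<open>
  By Cramer's rule the entries of the inverse are quotients of determinants. The value of the
  derivative is then forced by differentiating \<open>F F\<^sup>-\<^sup>1 = I\<close>.
\<close>

lemma differentiable_matrix_inv: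
  fixes F :: "real \<Rightarrow> complex^'n^'n"
  assumes F: "F differentiable (at t)" and inv: "invertible (F t)"
  shows "(\<lambda>s. matrix_inv (F s)) differentiable (at t)"
proof -
  (* the matrix whose determinant is the numerator of the (i, k) entry in Cramer's rule *)
  define N where "N i k s = (\<chi> a b. if b = i then (axis k 1 :: complex^'n) $ a else F s $ a $ b)"
    for i k :: 'n and s
  define G where "G s = (\<chi> i k. det (N i k s) / det (F s))" for s
  have "(\<lambda>s. N i k s $ a $ b) differentiable (at t)" for i k a b
    using differentiable_vec_nth[OF differentiable_vec_nth[OF F]]
    by (cases "b = i") (simp_all add: N_def)
  then have "N i k differentiable (at t)" for i k
    by (intro differentiable_vec_componentwise)
  then have "(\<lambda>s. G s $ i $ k) differentiable (at t)" for i k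
    unfolding G_def using inv
    by (auto intro!: differentiable_divide differentiable_det F simp: invertible_det_nz)
  then have G: "G differentiable (at t)"
    by (intro differentiable_vec_componentwise)
  have "matrix_inv (F s) = G s" if "invertible (F s)" for s
  proof (rule matrix_inv_unique)
    have "det (F s) \<noteq> 0" using that by (simp add: invertible_det_nz)
    then have "F s *v (\<chi> i. G s $ i $ k) = axis k 1" for k
      by (subst cramer) (auto simp: G_def N_def)
    then have "(F s ** G s) $ i $ k = (axis k 1 :: complex^'n) $ i" for i k
      by (simp add: vec_eq_iff matrix_matrix_mult_def matrix_vector_mult_def)
    then show "F s ** G s = mat 1"
      by (simp add: vec_eq_iff mat_def axis_def)
  qed
  then have "\<forall>\<^sub>F s in nhds t. matrix_inv (F s) = G s"
    using eventually_invertible[OF F inv] by (auto elim: eventually_mono)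
  moreover from G have "(G has_vector_derivative vector_derivative G (at t)) (at t)"
    by (simp add: vector_derivative_works)
  ultimately have "((\<lambda>s. matrix_inv (F s)) has_vector_derivative vector_derivative G (at t)) (at t)"
    by (subst has_vector_derivative_cong_ev[where g = G])
      (auto elim: eventually_mono dest: eventually_nhds_x_imp_x)
  then show ?thesis
    by (rule differentiableI_vector)
qed

lemma has_vector_derivative_matrix_inv:
  fixes F :: "real \<Rightarrow> complex^'n^'n"
  assumes F: "(F has_vector_derivative F') (at t)" and inv: "invertible (F t)"
  shows "((\<lambda>s. matrix_inv (F s)) has_vector_derivative
    - (matrix_inv (F t) ** F' ** matrix_inv (F t))) (at t)"
proof -
  have diff: "F differentiable (at t)"
    using F by (rule differentiableI_vector)
  obtain G' where G: "((\<lambda>s. matrix_inv (F s)) has_vector_derivative G') (at t)"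
    using differentiable_matrix_inv[OF diff inv] vector_derivative_works by blast
  have "\<forall>\<^sub>F s in nhds t. F s ** matrix_inv (F s) = mat 1"
    using eventually_invertible[OF diff inv]
    by eventually_elim (simp add: matrix_inv_right_left)
  then have "F t ** G' + F' ** matrix_inv (F t) = 0"
    by (rule has_vector_derivative_eventually_const[OF matrix_mult.has_vector_derivative[OF F G]])
  then have "F t ** G' = - (F' ** matrix_inv (F t))"
    by (simp add: add_eq_0_iff2)
  then have "matrix_inv (F t) ** (F t ** G') = - (matrix_inv (F t) ** F' ** matrix_inv (F t))"
    by (simp add: matrix_mult.minus_right matrix_mul_assoc)
  then have "G' = - (matrix_inv (F t) ** F' ** matrix_inv (F t))"
    by (simp add: matrix_mul_assoc matrix_inv_right_left inv)
  then show ?thesis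
    using G by simp
qed

text \<open>
  Normal form for noncommutative computations: everything is multiplied out, and products are
  nested to the right. Rules for inverses therefore have to be supplied in the form
  \<open>A (A\<^sup>-\<^sup>1 M) = M\<close>.
\<close>

lemmas matrix_ring_simps =
  matrix_mult.add_left matrix_mult.add_right matrix_mult.diff_left matrix_mult.diff_right
  matrix_mult.minus_left matrix_mult.minus_right matrix_mul_assoc[symmetric]

section \<open>The Sylvester identity\<close>

text \<open>
  Multiplying the identity by \<open>S\<^sup>-\<^sup>1\<close> on both sides gives a rule for moving \<open>S\<^sup>-\<^sup>1\<close> past \<open>A\<^sub>1\<close> and \<open>A\<^sub>2\<close>.
\<close>

lemma sylvester_inverse:
  fixes A1 A2 S :: "complex^'n^'n" and P :: "complex^2^'n" and W :: "complex^'n^2"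
  assumes "invertible S" and "A1 ** S - S ** A2 = P ** W"
  shows "matrix_inv S ** A1 = A2 ** matrix_inv S + matrix_inv S ** P ** W ** matrix_inv S"
proof -
  have "matrix_inv S ** (A1 ** S - S ** A2) ** matrix_inv S = matrix_inv S ** (P ** W) ** matrix_inv S"
    by (simp add: assms)
  moreover have "matrix_inv S ** (A1 ** S - S ** A2) ** matrix_inv S
    = matrix_inv S ** A1 ** (S ** matrix_inv S) - matrix_inv S ** S ** A2 ** matrix_inv S"
    by (simp add: matrix_ring_simps)
  ultimately show ?thesis
    by (simp add: matrix_inv_right_left[OF assms(1)] matrix_ring_simps)
qed

text \<open>
  With \<open>X\<close> and \<open>Y\<close> the matrices subtracted from and added to the identity, the commutation
  rule above turns \<open>Y X\<close> into \<open>Y - X\<close>.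
\<close>

lemma darboux_matrix_inverse:
  fixes A1 A2 S :: "complex^'n^'n" and P :: "complex^2^'n" and W :: "complex^'n^2"
  assumes "invertible S" "invertible A1" "invertible A2"
    and "A1 ** S - S ** A2 = P ** W"
  shows "(mat 1 + W ** matrix_inv A2 ** matrix_inv S ** P)
     ** (mat 1 - W ** matrix_inv S ** matrix_inv A1 ** P) = mat 1"
proof -
  let ?B = "matrix_inv A1" and ?C = "matrix_inv A2" and ?Si = "matrix_inv S"
  have "?Si ** P ** W ** ?Si = ?Si ** A1 - A2 ** ?Si"
    using sylvester_inverse[OF assms(1,4)] by simp
  then have "W ** ?C ** (?Si ** P ** W ** ?Si) ** ?B ** P = W ** ?C ** (?Si ** A1 - A2 ** ?Si) ** ?B ** P"
    by simp
  also have "\<dots> = W ** ?C ** ?Si ** (A1 ** ?B) ** P - W ** (?C ** A2) ** ?Si ** ?B ** P"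
    by (simp add: matrix_ring_simps)
  also have "\<dots> = W ** ?C ** ?Si ** P - W ** ?Si ** ?B ** P"
    by (simp add: matrix_inv_right_left assms)
  finally show ?thesis
    by (simp add: matrix_ring_simps)
qed

text \<open>
  In both directions the terms in the derivative of \<open>A\<^sub>1 S - S A\<^sub>2\<close> are exactly those that survive
  in the derivative of \<open>\<Pi>\<^sub>1 W\<close>.
\<close>

lemma sylvester_residual_x:
  fixes S :: "real \<Rightarrow> complex^'n^'n" and P :: "real \<Rightarrow> complex^2^'n" and W :: "real \<Rightarrow> complex^'n^2"
  assumes "(P has_vector_derivative P s ** q + A1 ** P s ** q') (at s)"
    and "(W has_vector_derivative - (q ** W s) - q' ** W s ** A2) (at s)"
    and "(S has_vector_derivative P s ** q' ** W s) (at s)"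
  shows "((\<lambda>s. A1 ** S s - S s ** A2 - P s ** W s) has_vector_derivative 0) (at s)"
  by (rule has_vector_derivative_eq_rhs, (rule has_vector_derivative_diff
      matrix_mult.has_vector_derivative has_vector_derivative_const assms)+)
    (simp add: matrix_ring_simps)

lemma sylvester_residual_t:
  fixes S :: "real \<Rightarrow> complex^'n^'n" and P :: "real \<Rightarrow> complex^2^'n" and W :: "real \<Rightarrow> complex^'n^2"
  assumes "invertible A1" "invertible A2"
    and "(P has_vector_derivative matrix_inv A1 ** P s ** Q) (at s)"
    and "(W has_vector_derivative - (Q ** W s ** matrix_inv A2)) (at s)"
    and "(S has_vector_derivative - (matrix_inv A1 ** P s ** Q ** W s ** matrix_inv A2)) (at s)"
  shows "((\<lambda>s. A1 ** S s - S s ** A2 - P s ** W s) has_vector_derivative 0) (at s)"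
proof -
  have cancel: "A1 ** (matrix_inv A1 ** M) = M" for M :: "complex^'n^'n"
    using assms(1) by (simp add: matrix_mul_assoc matrix_inv_right_left)
  show ?thesis
    by (rule has_vector_derivative_eq_rhs, (rule has_vector_derivative_diff
        matrix_mult.has_vector_derivative has_vector_derivative_const assms)+)
      (simp add: matrix_ring_simps cancel matrix_inv_right_left assms)
qed

section \<open>The Darboux transformation of the Lax equation\<close>

text \<open>
  The three terms of the product rule are \<open>- Q Y\<close>, \<open>X Q Y\<close> and \<open>X Q\<close>, which are what
  \<open>Q - (I - X) Q (I + Y)\<close> expands to; \<open>X\<close> and \<open>Y\<close> are the matrices in the two outer factors.
\<close>

lemma X0_t:
  fixes S :: "real \<Rightarrow> complex^'n^'n" and P :: "real \<Rightarrow> complex^2^'n" and W :: "real \<Rightarrow> complex^'n^2"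
  assumes "(P has_vector_derivative B ** P s ** Q) (at s)"
    and "(W has_vector_derivative - (Q ** W s ** C)) (at s)"
    and "(S has_vector_derivative - (B ** P s ** Q ** W s ** C)) (at s)"
    and "invertible (S s)"
  shows "((\<lambda>s. W s ** matrix_inv (S s) ** P s) has_vector_derivative
    Q - (mat 1 - W s ** matrix_inv (S s) ** B ** P s) ** Q
      ** (mat 1 + W s ** C ** matrix_inv (S s) ** P s)) (at s)"
  by (rule has_vector_derivative_eq_rhs, (rule
      matrix_mult.has_vector_derivative has_vector_derivative_matrix_inv assms)+)
    (simp add: matrix_ring_simps)

text \<open>
  The factor \<open>A\<^sub>2\<close> in \<open>W\<^sub>x\<close> is moved past \<open>S\<^sup>-\<^sup>1\<close> by the Sylvester identity, where it becomes the factor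
  \<open>A\<^sub>1\<close> that cancels \<open>A\<^sub>1\<^sup>-\<^sup>1\<close>. Every term is then a product of \<open>q\<close>, \<open>q'\<close>, \<open>X\<close> and
  \<open>W S\<^sup>-\<^sup>1 A\<^sub>1\<^sup>-\<^sup>1 \<Pi>\<^sub>1\<close>.
\<close>

lemma darboux_matrix_x:
  fixes S :: "real \<Rightarrow> complex^'n^'n" and P :: "real \<Rightarrow> complex^2^'n" and W :: "real \<Rightarrow> complex^'n^2"
    and A1 A2 :: "complex^'n^'n"
  assumes "(P has_vector_derivative P s ** q + A1 ** P s ** q') (at s)"
    and "(W has_vector_derivative - (q ** W s) - q' ** W s ** A2) (at s)"
    and "(S has_vector_derivative P s ** q' ** W s) (at s)"
    and "invertible (S s)" "invertible A1"
    and "A1 ** S s - S s ** A2 = P s ** W s"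
  defines "T \<equiv> \<lambda>s. mat 1 - W s ** matrix_inv (S s) ** matrix_inv A1 ** P s"
    and "X \<equiv> W s ** matrix_inv (S s) ** P s"
  shows "(T has_vector_derivative T s ** q - (q - (q' ** X - X ** q')) ** T s) (at s)"
proof -
  have syl: "A2 ** (matrix_inv (S s) ** Z)
    = matrix_inv (S s) ** (A1 ** Z) - matrix_inv (S s) ** (P s ** (W s ** (matrix_inv (S s) ** Z)))"
    for Z :: "complex^2^'n"
    using arg_cong[OF sylvester_inverse[OF assms(4,6)], of "\<lambda>M. M ** Z"] by (simp add: matrix_ring_simps)
  have cancel: "A1 ** (matrix_inv A1 ** Z) = Z" "matrix_inv A1 ** (A1 ** Z) = Z" for Z :: "complex^2^'n"
    using assms(5) by (simp_all add: matrix_mul_assoc matrix_inv_right_left)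
  show ?thesis
    unfolding T_def X_def
    by (rule has_vector_derivative_eq_rhs, (rule has_vector_derivative_diff
        matrix_mult.has_vector_derivative has_vector_derivative_const
        has_vector_derivative_matrix_inv assms)+)
      (simp add: matrix_ring_simps syl cancel)
qed

text \<open>
  The mirror image: here the factor \<open>A\<^sub>1\<close> in \<open>(\<Pi>\<^sub>1)\<^sub>x\<close> is moved to the left past
  \<open>S\<^sup>-\<^sup>1\<close>, where it becomes the factor \<open>A\<^sub>2\<close> that cancels \<open>A\<^sub>2\<^sup>-\<^sup>1\<close>.
\<close>

lemma darboux_matrix_inverse_x:
  fixes S :: "real \<Rightarrow> complex^'n^'n" and P :: "real \<Rightarrow> complex^2^'n" and W :: "real \<Rightarrow> complex^'n^2"
    and A1 A2 :: "complex^'n^'n"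
  assumes "(P has_vector_derivative P s ** q + A1 ** P s ** q') (at s)"
    and "(W has_vector_derivative - (q ** W s) - q' ** W s ** A2) (at s)"
    and "(S has_vector_derivative P s ** q' ** W s) (at s)"
    and "invertible (S s)" "invertible A2"
    and "A1 ** S s - S s ** A2 = P s ** W s"
  defines "Z \<equiv> \<lambda>s. mat 1 + W s ** matrix_inv A2 ** matrix_inv (S s) ** P s"
    and "X \<equiv> W s ** matrix_inv (S s) ** P s"
  shows "(Z has_vector_derivative Z s ** (q - (q' ** X - X ** q')) - q ** Z s) (at s)"
proof -
  have syl: "matrix_inv (S s) ** (A1 ** Z)
    = A2 ** (matrix_inv (S s) ** Z) + matrix_inv (S s) ** (P s ** (W s ** (matrix_inv (S s) ** Z)))"
    for Z :: "complex^2^'n"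
    using arg_cong[OF sylvester_inverse[OF assms(4,6)], of "\<lambda>M. M ** Z"] by (simp add: matrix_ring_simps)
  have cancel: "A2 ** (matrix_inv A2 ** Z) = Z" "matrix_inv A2 ** (A2 ** Z) = Z" for Z :: "complex^2^'n"
    using assms(5) by (simp_all add: matrix_mul_assoc matrix_inv_right_left)
  show ?thesis
    unfolding Z_def X_def
    by (rule has_vector_derivative_eq_rhs, (rule has_vector_derivative_add
        matrix_mult.has_vector_derivative has_vector_derivative_const
        has_vector_derivative_matrix_inv assms)+)
      (simp add: matrix_ring_simps syl cancel)
qed

lemma lax_equation_conjugate:
  fixes T Q Z :: "real \<Rightarrow> complex^'n^'n"
  assumes "(T has_vector_derivative T s ** q - q' ** T s) (at s)"
    and "(Z has_vector_derivative Z s ** q' - q ** Z s) (at s)"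
    and "(Q has_vector_derivative Q s ** q - q ** Q s) (at s)"
  shows "((\<lambda>s. T s ** Q s ** Z s) has_vector_derivative
    (T s ** Q s ** Z s) ** q' - q' ** (T s ** Q s ** Z s)) (at s)"
  by (rule has_vector_derivative_eq_rhs, (rule matrix_mult.has_vector_derivative assms)+)
    (simp add: matrix_ring_simps)

section \<open>The Lax pair in terms of scalar functions\<close>

text \<open>
  The coefficients \<open>Q\<^sub>-\<^sub>1\<close> and \<open>q\<^sub>0\<close> as functions of the values of their scalar ingredients, so
  that one formula serves both the seed and the transformed functions: \<open>r\<close> stands for \<open>\<rho>\<close>, \<open>u1\<close>
  and \<open>u2\<close> for the entries of the potential, \<open>d1\<close> and \<open>d2\<close> for their \<open>t\<close>-derivatives.
\<close>

definition lax_t :: "nat \<Rightarrow> complex \<Rightarrow> complex \<Rightarrow> complex \<Rightarrow> complex^2^2"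
  where "lax_t p r d1 d2 = \<i> \<cdot>\<^sub>C (j ** (r \<cdot>\<^sub>C mat 1)) - mpow j p ** antidiag d1 d2"

definition lax_x :: "nat \<Rightarrow> complex \<Rightarrow> complex \<Rightarrow> complex^2^2"
  where "lax_x p u1 u2 = (\<i> / 2) \<cdot>\<^sub>C (mpow j (p + 1) ** antidiag u1 u2)"

lemmas matrix2_simps = vec_eq_iff forall_2 matrix_matrix_mult_def sum_2 mat_def cscale_def
  j_def antidiag_def

text \<open>
  The right-hand side is \<open>lax_t\<close> applied to the \<open>x\<close>-derivatives that the differential equations
  prescribe for \<open>r\<close>, \<open>d1\<close> and \<open>d2\<close>. As \<open>lax_t\<close> is linear and injective in these three arguments,
  the equations are equivalent to the Lax equation.
\<close>

lemma lax_commutator: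
  assumes "p \<in> {0, 1}"
  shows "lax_t p r d1 d2 ** lax_x p u1 u2 - lax_x p u1 u2 ** lax_t p r d1 d2
    = lax_t p ((-1) ^ p / 2 * (u1 * d2 + d1 * u2)) (r * u1) (r * u2)"
  using assms by (auto simp: lax_t_def lax_x_def matrix2_simps field_simps)

lemma lax_t_entries:
  assumes "p \<in> {0, 1}"
  shows "lax_t p r d1 d2 $ 1 $ 1 = \<i> * r" "lax_t p r d1 d2 $ 1 $ 2 = - d1"
    "lax_t p r d1 d2 $ 2 $ 1 = - ((-1) ^ p * d2)" "lax_t p r d1 d2 $ 2 $ 2 = - \<i> * r"
  using assms by (auto simp: lax_t_def matrix2_simps)

lemma lax_t_traceless:
  assumes "p \<in> {0, 1}" and "trace M = 0"
  shows "M = lax_t p (\<i> * M $ 2 $ 2) (- M $ 1 $ 2) (- ((-1) ^ p * M $ 2 $ 1))"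
proof -
  have "M $ 1 $ 1 = - M $ 2 $ 2"
    using assms(2) by (simp add: trace_def sum_2 add_eq_0_iff2)
  then show ?thesis
    using assms(1) by (auto simp: lax_t_entries vec_eq_iff forall_2)
qed

lemma Vtilde_entries:
  assumes "p \<in> {0, 1}"
  shows "Vtilde p V X $ 1 $ 2 = V $ 1 $ 2 + X $ 1 $ 2"
    "Vtilde p V X $ 2 $ 1 = V $ 2 $ 1 + (-1) ^ p * X $ 2 $ 1"
  using assms by (auto simp: Vtilde_def matrix2_simps)

text \<open>
  The commutator with \<open>q1\<close>, a multiple of \<open>j\<close>, sees only the off-diagonal part of \<open>X\<close>, and so does
  the correction term in \<open>Vtilde\<close>.
\<close>

lemma lax_x_Vtilde:
  assumes "p \<in> {0, 1}" and "antidiag w1 w2 = Vtilde p (antidiag u1 u2) X"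
  shows "lax_x p w1 w2 = lax_x p u1 u2 - (q1 ** X - X ** q1)"
proof -
  have "w1 = u1 + X $ 1 $ 2" "w2 = u2 + (-1) ^ p * X $ 2 $ 1"
    using Vtilde_entries[OF assms(1), of "antidiag u1 u2" X, folded assms(2)]
    by (simp_all add: antidiag_def)
  then show ?thesis
    using assms(1) by (auto simp: lax_x_def q1_def matrix2_simps field_simps)
qed

lemma dt_antidiag:
  assumes "(\<lambda>\<tau>. antidiag (u1 x \<tau>) (u2 x \<tau>)) differentiable (at t)"
  defines "M \<equiv> dt (\<lambda>x t. antidiag (u1 x t) (u2 x t)) x t"
  shows "(u1 x has_vector_derivative M $ 1 $ 2) (at t)"
    and "(u2 x has_vector_derivative M $ 2 $ 1) (at t)"
    and "M = antidiag (M $ 1 $ 2) (M $ 2 $ 1)"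
proof -
  have M: "((\<lambda>\<tau>. antidiag (u1 x \<tau>) (u2 x \<tau>)) has_vector_derivative M) (at t)"
    using assms by (simp add: dt_def vector_derivative_works)
  have entry: "((\<lambda>\<tau>. antidiag (u1 x \<tau>) (u2 x \<tau>) $ i $ k) has_vector_derivative M $ i $ k) (at t)"
    for i k
    by (intro bounded_linear.has_vector_derivative[OF bounded_linear_vec_nth] M)
  show "(u1 x has_vector_derivative M $ 1 $ 2) (at t)"
    and "(u2 x has_vector_derivative M $ 2 $ 1) (at t)"
    using entry[of 1 2] entry[of 2 1] by (simp_all add: antidiag_def)
  have "((\<lambda>\<tau>. 0) has_vector_derivative M $ 1 $ 1) (at t)"
    "((\<lambda>\<tau>. 0) has_vector_derivative M $ 2 $ 2) (at t)"
    using entry[of 1 1] entry[of 2 2] by (simp_all add: antidiag_def)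
  then have "M $ 1 $ 1 = 0" "M $ 2 $ 2 = 0"
    by (metis has_vector_derivative_const vector_derivative_unique_at)+
  then show "M = antidiag (M $ 1 $ 2) (M $ 2 $ 1)"
    by (simp add: antidiag_def vec_eq_iff forall_2)
qed

section \<open>Lines in the rectangle\<close>

lemma ereal_interval_constant:
  fixes f :: "real \<Rightarrow> 'a::real_normed_vector"
  assumes "0 \<in> {s. a < ereal s \<and> ereal s < b}" "s \<in> {s. a < ereal s \<and> ereal s < b}"
    and "\<And>s. a < ereal s \<Longrightarrow> ereal s < b \<Longrightarrow> (f has_vector_derivative 0) (at s)"
  shows "f s = f 0"
proof -
  have "convex {s. a < ereal s \<and> ereal s < b}"
    unfolding is_interval_convex_1[symmetric] is_interval_1
    by (metis (mono_tags, lifting) ereal_less_eq(3) le_less_trans less_le_trans mem_Collect_eq)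
  then obtain c where "\<And>s. s \<in> {s. a < ereal s \<and> ereal s < b} \<Longrightarrow> f s = c"
    by (rule has_vector_derivative_zero_constant[where f=f])
       (auto intro: has_vector_derivative_at_within assms(3))
  then show ?thesis using assms(1,2) by metis
qed

lemma eventually_rectangle:
  assumes "(x, t) \<in> rectangle a1 a2 b1 b2"
  shows "\<forall>\<^sub>F \<xi> in nhds x. (\<xi>, t) \<in> rectangle a1 a2 b1 b2"
    and "\<forall>\<^sub>F \<tau> in nhds t. (x, \<tau>) \<in> rectangle a1 a2 b1 b2"
proof -
  have "\<forall>\<^sub>F s in nhds u. a < ereal s \<and> ereal s < b"
    if "a < ereal u" "ereal u < b" for a b u
  proof -
    have "(ereal \<longlongrightarrow> ereal u) (nhds u)"
      by (intro tendsto_ereal filterlim_ident)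
    from order_tendstoD[OF this] that show ?thesis
      by (simp add: eventually_conj_iff)
  qed
  then show "\<forall>\<^sub>F \<xi> in nhds x. (\<xi>, t) \<in> rectangle a1 a2 b1 b2"
    and "\<forall>\<^sub>F \<tau> in nhds t. (x, \<tau>) \<in> rectangle a1 a2 b1 b2"
    using assms by (auto simp: rectangle_def eventually_conj_iff)
qed

section \<open>The transformed functions solve the equations\<close>

theorem corollary5p1:
  fixes p :: nat
    and a1 a2 b1 b2 :: ereal
    and D :: "(real \<times> real) set"
    and \<rho> v1 v2 :: "real \<Rightarrow> real \<Rightarrow> complex"
    and R V :: "real \<Rightarrow> real \<Rightarrow> complex^2^2"
    and A1 A2 :: "complex^'n^'n"
    and \<Pi>1 \<Pi>2 :: "real \<Rightarrow> real \<Rightarrow> complex^2^'n"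
    and S :: "real \<Rightarrow> real \<Rightarrow> complex^'n^'n"
    and \<rho>' v1' v2' :: "real \<Rightarrow> real \<Rightarrow> complex"
  assumes "p \<in> {0, 1}"
    and "a1 < 0" and "0 < a2" and "b1 < 0" and "0 < b2"
    and "D = rectangle a1 a2 b1 b2"
    and "R = (\<lambda>x t. \<rho> x t \<cdot>\<^sub>C mat 1)"
    and "V = (\<lambda>x t. antidiag (v1 x t) (v2 x t))"
    and "\<forall>(x, t) \<in> D. (\<lambda>\<tau>. V x \<tau>) differentiable (at t)"
    and "continuous_on D (\<lambda>(x, t). dt V x t)"
    and "\<forall>(x, t) \<in> D. has_dx R (((-1) ^ p / 2) \<cdot>\<^sub>C (V x t ** dt V x t + dt V x t ** V x t)) x t"
    and "\<forall>(x, t) \<in> D. has_dx (dt V) ((1/2) \<cdot>\<^sub>C (V x t ** R x t + R x t ** V x t)) x t"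
    and "invertible A1" and "invertible A2" and "invertible (S 0 0)"
    and "A1 ** S 0 0 - S 0 0 ** A2 = \<Pi>1 0 0 ** ctranspose (\<Pi>2 0 0)"
    and "linear_systems D p R V A1 A2 \<Pi>1 \<Pi>2 S"
    and "\<forall>(x, t) \<in> D. invertible (S x t) \<longrightarrow>
           antidiag (v1' x t) (v2' x t) = Vtilde p (V x t) (X0 (\<Pi>1 x t) (\<Pi>2 x t) (S x t))"
    and "\<forall>(x, t) \<in> D. invertible (S x t) \<longrightarrow>
           \<rho>' x t = \<i> * Qtilde A1 A2 (\<Pi>1 x t) (\<Pi>2 x t) (S x t) (Qm1 p R V x t) $ 2 $ 2"
  shows "\<forall>(x, t) \<in> D. invertible (S x t) \<longrightarrow>
           (\<lambda>\<tau>. v1' x \<tau>) differentiable (at t) \<and>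
           (\<lambda>\<tau>. v2' x \<tau>) differentiable (at t) \<and>
           has_dx \<rho>' ((-1) ^ p / 2 * (v1' x t * dt v2' x t + dt v1' x t * v2' x t)) x t \<and>
           has_dx (dt v1') (\<rho>' x t * v1' x t) x t \<and>
           has_dx (dt v2') (\<rho>' x t * v2' x t) x t"
proof -
  note D = assms(6) and R = assms(7) and V = assms(8) and p = assms(1)
  note inv12 = assms(13,14)
  define B where "B = matrix_inv A1"
  define C where "C = matrix_inv A2"
  define W where "W x t = ctranspose (\<Pi>2 x t)" for x t
  define Q where "Q = Qm1 p R V"
  define d1 where "d1 x t = dt V x t $ 1 $ 2" for x t
  define d2 where "d2 x t = dt V x t $ 2 $ 1" for x t
  define Qt where "Qt x t = Qtilde A1 A2 (\<Pi>1 x t) (\<Pi>2 x t) (S x t) (Q x t)" for x t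
  define X where "X x t = X0 (\<Pi>1 x t) (\<Pi>2 x t) (S x t)" for x t
  define T where "T x t = mat 1 - W x t ** matrix_inv (S x t) ** B ** \<Pi>1 x t" for x t
  define Z where "Z x t = mat 1 + W x t ** C ** matrix_inv (S x t) ** \<Pi>1 x t" for x t
  have X_eq: "X x t = W x t ** matrix_inv (S x t) ** \<Pi>1 x t" for x t
    by (simp add: X_def X0_def W_def)
  have Qt_eq: "Qt x t = T x t ** Q x t ** Z x t" for x t
    by (simp add: Qt_def Qtilde_def T_def Z_def Xm1_def Ym1_def W_def B_def C_def)

  have dV: "(v1 x has_vector_derivative d1 x t) (at t)" "(v2 x has_vector_derivative d2 x t) (at t)"
    "dt V x t = antidiag (d1 x t) (d2 x t)" if "(x, t) \<in> D" for x t
    unfolding d1_def d2_def V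
    by (rule dt_antidiag; use assms(9) that in \<open>auto simp: V\<close>)+
  have V_at: "V x t = antidiag (v1 x t) (v2 x t)" and R_at: "R x t = \<rho> x t \<cdot>\<^sub>C mat 1" for x t
    by (simp_all add: V R)
  have q0_eq: "q0 p V x t = lax_x p (v1 x t) (v2 x t)" for x t
    by (simp add: q0_def lax_x_def V_at)
  have Q_eq: "Q x t = lax_t p (\<rho> x t) (d1 x t) (d2 x t)" if "(x, t) \<in> D" for x t
    by (simp add: Q_def Qm1_def lax_t_def R_at dV(3)[OF that])
  (* This is where the differential equations for the given functions enter. *)
  have Q_x: "((\<lambda>\<xi>. Q \<xi> t) has_vector_derivative Q x t ** q0 p V x t - q0 p V x t ** Q x t) (at x)"
    if xt: "(x, t) \<in> D" for x t
  proof -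
    let ?r = "(-1) ^ p / 2 * (v1 x t * d2 x t + d1 x t * v2 x t)"
    have "((-1) ^ p / 2) \<cdot>\<^sub>C (V x t ** dt V x t + dt V x t ** V x t) = ?r \<cdot>\<^sub>C mat 1"
      by (simp add: dV(3)[OF xt] V_at matrix2_simps algebra_simps)
    then have R_x: "((\<lambda>\<xi>. R \<xi> t) has_vector_derivative ?r \<cdot>\<^sub>C mat 1) (at x)"
      using assms(11) xt by (auto simp: has_dx_def)
    have "(1/2) \<cdot>\<^sub>C (V x t ** R x t + R x t ** V x t)
        = antidiag (\<rho> x t * v1 x t) (\<rho> x t * v2 x t)"
      by (simp add: R_at V_at matrix2_simps algebra_simps)
    then have V_tx: "((\<lambda>\<xi>. dt V \<xi> t) has_vector_derivative
        antidiag (\<rho> x t * v1 x t) (\<rho> x t * v2 x t)) (at x)"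
      using assms(12) xt by (auto simp: has_dx_def)
    have "((\<lambda>\<xi>. Q \<xi> t) has_vector_derivative
        lax_t p ?r (\<rho> x t * v1 x t) (\<rho> x t * v2 x t)) (at x)"
      unfolding Q_def Qm1_def lax_t_def
      by (intro has_vector_derivative_diff bounded_linear.has_vector_derivative[OF bounded_linear_cscale]
          bounded_linear.has_vector_derivative[OF matrix_mult.bounded_linear_right] R_x V_tx)
    then show ?thesis
      by (simp add: Q_eq[OF xt] q0_eq lax_commutator[OF p])
  qed

  have P_x: "((\<lambda>\<xi>. \<Pi>1 \<xi> t) has_vector_derivative \<Pi>1 x t ** q0 p V x t + A1 ** \<Pi>1 x t ** q1) (at x)"
    and P_t: "((\<lambda>\<tau>. \<Pi>1 x \<tau>) has_vector_derivative B ** \<Pi>1 x t ** Q x t) (at t)"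
    and W_x: "((\<lambda>\<xi>. W \<xi> t) has_vector_derivative - (q0 p V x t ** W x t) - q1 ** W x t ** A2) (at x)"
    and W_t: "((\<lambda>\<tau>. W x \<tau>) has_vector_derivative - (Q x t ** W x t ** C)) (at t)"
    and S_x: "((\<lambda>\<xi>. S \<xi> t) has_vector_derivative \<Pi>1 x t ** q1 ** W x t) (at x)"
    and S_t: "((\<lambda>\<tau>. S x \<tau>) has_vector_derivative - (B ** \<Pi>1 x t ** Q x t ** W x t ** C)) (at t)"
    if "(x, t) \<in> D" for x t
  proof -
    note sys = bspec[OF assms(17)[unfolded linear_systems_def] that, unfolded has_dx_def has_dt_def prod.case]
    note ct = ctranspose_diff ctranspose_minus ctranspose_mult ctranspose_ctranspose
      matrix_inv_ctranspose[OF inv12(2)] matrix_mul_assoc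
    show "((\<lambda>\<xi>. \<Pi>1 \<xi> t) has_vector_derivative \<Pi>1 x t ** q0 p V x t + A1 ** \<Pi>1 x t ** q1) (at x)"
      "((\<lambda>\<tau>. \<Pi>1 x \<tau>) has_vector_derivative B ** \<Pi>1 x t ** Q x t) (at t)"
      "((\<lambda>\<xi>. S \<xi> t) has_vector_derivative \<Pi>1 x t ** q1 ** W x t) (at x)"
      "((\<lambda>\<tau>. S x \<tau>) has_vector_derivative - (B ** \<Pi>1 x t ** Q x t ** W x t ** C)) (at t)"
      using sys by (auto simp: B_def C_def Q_def W_def)
    have "((\<lambda>\<xi>. \<Pi>2 \<xi> t) has_vector_derivative - (\<Pi>2 x t ** ctranspose (q0 p V x t))
        - ctranspose A2 ** \<Pi>2 x t ** ctranspose q1) (at x)"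
      using sys by auto
    from bounded_linear.has_vector_derivative[OF bounded_linear_ctranspose this]
    show "((\<lambda>\<xi>. W \<xi> t) has_vector_derivative - (q0 p V x t ** W x t) - q1 ** W x t ** A2) (at x)"
      by (simp add: W_def ct)
    have "((\<lambda>\<tau>. \<Pi>2 x \<tau>) has_vector_derivative
        - (matrix_inv (ctranspose A2) ** \<Pi>2 x t ** ctranspose (Qm1 p R V x t))) (at t)"
      using sys by auto
    from bounded_linear.has_vector_derivative[OF bounded_linear_ctranspose this]
    show "((\<lambda>\<tau>. W x \<tau>) has_vector_derivative - (Q x t ** W x t ** C)) (at t)"
      by (simp add: W_def C_def Q_def ct)
  qed

  (* The identity is transported from the origin, first along the x-axis and then vertically;
     both segments stay in the rectangle. *)
  have syl: "A1 ** S x t - S x t ** A2 = \<Pi>1 x t ** W x t" if xt: "(x, t) \<in> D" for x t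
  proof -
    define F where "F x t = A1 ** S x t - S x t ** A2 - \<Pi>1 x t ** W x t" for x t
    have F_x: "((\<lambda>\<xi>. F \<xi> t) has_vector_derivative 0) (at x)" if "(x, t) \<in> D" for x t
      unfolding F_def by (rule sylvester_residual_x[OF P_x[OF that] W_x[OF that] S_x[OF that]])
    have F_t: "((\<lambda>\<tau>. F x \<tau>) has_vector_derivative 0) (at t)" if "(x, t) \<in> D" for x t
      unfolding F_def
      by (rule sylvester_residual_t[OF inv12 P_t[OF that, unfolded B_def]
            W_t[OF that, unfolded C_def] S_t[OF that, unfolded B_def C_def]])
    have "F x t = F x 0"
      by (rule ereal_interval_constant[where a = b1 and b = b2])
        (use xt \<open>b1 < 0\<close> \<open>0 < b2\<close> in \<open>auto simp: D rectangle_def zero_ereal_def intro!: F_t\<close>)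
    also have "\<dots> = F 0 0"
      by (rule ereal_interval_constant[where a = a1 and b = a2 and f = "\<lambda>x. F x 0"])
        (use xt \<open>a1 < 0\<close> \<open>0 < a2\<close> \<open>b1 < 0\<close> \<open>0 < b2\<close> in
          \<open>auto simp: D rectangle_def zero_ereal_def intro!: F_x\<close>)
    also have "\<dots> = 0"
      using assms(16) by (simp add: F_def W_def)
    finally show ?thesis
      by (simp add: F_def)
  qed

  have near_x: "\<forall>\<^sub>F \<xi> in nhds x. (\<xi>, t) \<in> D \<and> invertible (S \<xi> t)"
    and near_t: "\<forall>\<^sub>F \<tau> in nhds t. (x, \<tau>) \<in> D \<and> invertible (S x \<tau>)"
    if "(x, t) \<in> D" "invertible (S x t)" for x t
    using that eventually_rectangle[of x t a1 a2 b1 b2]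
      eventually_invertible[of "\<lambda>\<xi>. S \<xi> t" x] differentiableI_vector[OF S_x[OF that(1)]]
      eventually_invertible[of "\<lambda>\<tau>. S x \<tau>" t] differentiableI_vector[OF S_t[OF that(1)]]
    by (auto simp: D eventually_conj_iff)

  have v': "antidiag (v1' x t) (v2' x t) = Vtilde p (antidiag (v1 x t) (v2 x t)) (X x t)"
    and \<rho>'_eq: "\<rho>' x t = \<i> * Qt x t $ 2 $ 2"
    if "(x, t) \<in> D" "invertible (S x t)" for x t
    using that assms(18)
      assms(19)
    by (auto simp: V X_def Qt_def Q_def)
  have v'_eq: "v1' x t = v1 x t + X x t $ 1 $ 2" "v2' x t = v2 x t + (-1) ^ p * X x t $ 2 $ 1"
    if "(x, t) \<in> D" "invertible (S x t)" for x t
    using Vtilde_entries[OF p, of "antidiag (v1 x t) (v2 x t)" "X x t", folded v'[OF that]]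
    by (simp_all add: antidiag_def)

  (* The seed part of X_t = Q - Qt cancels the derivative of the seed potential. *)
  have v'_t: "(v1' x has_vector_derivative - Qt x t $ 1 $ 2) (at t)"
    "(v2' x has_vector_derivative - ((-1) ^ p * Qt x t $ 2 $ 1)) (at t)"
    if xt: "(x, t) \<in> D" "invertible (S x t)" for x t
  proof -
    have "((\<lambda>\<tau>. X x \<tau>) has_vector_derivative Q x t - Qt x t) (at t)"
      unfolding X_eq Qt_eq T_def Z_def
      by (rule X0_t[OF P_t[OF xt(1)] W_t[OF xt(1)] S_t[OF xt(1)] xt(2)])
    then have X_t: "((\<lambda>\<tau>. X x \<tau> $ i $ k) has_vector_derivative (Q x t - Qt x t) $ i $ k) (at t)" for i k
      by (intro bounded_linear.has_vector_derivative[OF bounded_linear_vec_nth])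
    have "((\<lambda>\<tau>. v1 x \<tau> + X x \<tau> $ 1 $ 2) has_vector_derivative - Qt x t $ 1 $ 2) (at t)"
      by (rule has_vector_derivative_eq_rhs[OF has_vector_derivative_add[OF dV(1)[OF xt(1)] X_t]])
        (simp add: Q_eq[OF xt(1)] lax_t_entries[OF p])
    then show "(v1' x has_vector_derivative - Qt x t $ 1 $ 2) (at t)"
      using near_t[OF xt] v'_eq(1)[OF xt]
      by (subst has_vector_derivative_cong_ev[where g = "\<lambda>\<tau>. v1 x \<tau> + X x \<tau> $ 1 $ 2"])
        (auto elim!: eventually_mono simp: v'_eq)
    have "((\<lambda>\<tau>. v2 x \<tau> + (-1) ^ p * X x \<tau> $ 2 $ 1) has_vector_derivative
        - ((-1) ^ p * Qt x t $ 2 $ 1)) (at t)"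
      by (rule has_vector_derivative_eq_rhs[OF has_vector_derivative_add[OF dV(2)[OF xt(1)]
              has_vector_derivative_mult_right[OF X_t]]])
        (use p in \<open>auto simp: Q_eq[OF xt(1)] lax_t_entries[OF p]\<close>)
    then show "(v2' x has_vector_derivative - ((-1) ^ p * Qt x t $ 2 $ 1)) (at t)"
      using near_t[OF xt] v'_eq(2)[OF xt]
      by (subst has_vector_derivative_cong_ev[where g = "\<lambda>\<tau>. v2 x \<tau> + (-1) ^ p * X x \<tau> $ 2 $ 1"])
        (auto elim!: eventually_mono simp: v'_eq)
  qed
  then have dt_v': "dt v1' x t = - Qt x t $ 1 $ 2" "dt v2' x t = - ((-1) ^ p * Qt x t $ 2 $ 1)"
    if "(x, t) \<in> D" "invertible (S x t)" for x t
    using that by (auto simp: dt_def intro: vector_derivative_at)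

  (* The entries outside the diagonal are known from v'_t and the last one from the definition
     of \<rho>'; similarity to Q gives the first one. *)
  have Qt_lax: "Qt x t = lax_t p (\<rho>' x t) (dt v1' x t) (dt v2' x t)"
    if xt: "(x, t) \<in> D" "invertible (S x t)" for x t
  proof -
    have "Z x t ** T x t = mat 1"
      unfolding Z_def T_def B_def C_def
      by (rule darboux_matrix_inverse[OF xt(2) inv12 syl[OF xt(1)]])
    then have "trace (Qt x t) = trace (Q x t)"
      using trace_mul_sym[of "T x t ** Q x t" "Z x t"]
      by (simp add: Qt_eq matrix_mul_assoc)
    also have "\<dots> = 0"
      by (simp add: trace_def sum_2 Q_eq[OF xt(1)] lax_t_entries[OF p])
    finally show ?thesis
      using lax_t_traceless[OF p, of "Qt x t"] by (simp add: \<rho>'_eq dt_v' xt)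
  qed

  have Qt_x: "((\<lambda>\<xi>. Qt \<xi> t) has_vector_derivative
      lax_t p ((-1) ^ p / 2 * (v1' x t * dt v2' x t + dt v1' x t * v2' x t))
        (\<rho>' x t * v1' x t) (\<rho>' x t * v2' x t)) (at x)"
    if xt: "(x, t) \<in> D" "invertible (S x t)" for x t
  proof -
    let ?q = "q0 p V x t - (q1 ** X x t - X x t ** q1)"
    have q: "lax_x p (v1' x t) (v2' x t) = ?q"
      using lax_x_Vtilde[OF p v'[OF xt]] by (simp add: q0_eq)
    have "((\<lambda>\<xi>. T \<xi> t) has_vector_derivative T x t ** q0 p V x t - ?q ** T x t) (at x)"
      unfolding X_eq T_def B_def
      by (rule darboux_matrix_x[OF P_x[OF xt(1)] W_x[OF xt(1)] S_x[OF xt(1)] xt(2) inv12(1) syl[OF xt(1)]])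
    moreover have "((\<lambda>\<xi>. Z \<xi> t) has_vector_derivative Z x t ** ?q - q0 p V x t ** Z x t) (at x)"
      unfolding X_eq Z_def C_def
      by (rule darboux_matrix_inverse_x[OF P_x[OF xt(1)] W_x[OF xt(1)] S_x[OF xt(1)] xt(2) inv12(2) syl[OF xt(1)]])
    ultimately have "((\<lambda>\<xi>. Qt \<xi> t) has_vector_derivative Qt x t ** ?q - ?q ** Qt x t) (at x)"
      unfolding Qt_eq using Q_x[OF xt(1)] by (rule lax_equation_conjugate)
    then show ?thesis
      by (simp add: q[symmetric] Qt_lax[OF xt] lax_commutator[OF p])
  qed

  have "(\<lambda>\<tau>. v1' x \<tau>) differentiable (at t) \<and>
           (\<lambda>\<tau>. v2' x \<tau>) differentiable (at t) \<and>
           has_dx \<rho>' ((-1) ^ p / 2 * (v1' x t * dt v2' x t + dt v1' x t * v2' x t)) x t \<and>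
           has_dx (dt v1') (\<rho>' x t * v1' x t) x t \<and>
           has_dx (dt v2') (\<rho>' x t * v2' x t) x t"
    if xt: "(x, t) \<in> D" "invertible (S x t)" for x t
  proof -
    define L where "L = lax_t p ((-1) ^ p / 2 * (v1' x t * dt v2' x t + dt v1' x t * v2' x t))
        (\<rho>' x t * v1' x t) (\<rho>' x t * v2' x t)"
    (* Functions that agree with a multiple of an entry of Qt wherever S is invertible agree
       with it near x, and so have the same derivative. *)
    have entry_x: "has_dx f (c * L $ i $ k) x t"
      if "\<And>\<xi>. (\<xi>, t) \<in> D \<Longrightarrow> invertible (S \<xi> t) \<Longrightarrow> f \<xi> t = c * Qt \<xi> t $ i $ k"
      for f :: "real \<Rightarrow> real \<Rightarrow> complex" and c i k
    proof -
      have "((\<lambda>\<xi>. c * Qt \<xi> t $ i $ k) has_vector_derivative c * L $ i $ k) (at x)"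
        unfolding L_def
        by (intro has_vector_derivative_mult_right
            bounded_linear.has_vector_derivative[OF bounded_linear_vec_nth] Qt_x xt)
      moreover have "\<forall>\<^sub>F \<xi> in nhds x. f \<xi> t = c * Qt \<xi> t $ i $ k"
        using near_x[OF xt] by eventually_elim (auto intro: that)
      ultimately show ?thesis
        unfolding has_dx_def using that[OF xt]
        by (subst has_vector_derivative_cong_ev[where g = "\<lambda>\<xi>. c * Qt \<xi> t $ i $ k"])
          (auto elim: eventually_mono)
    qed
    have "has_dx \<rho>' ((-1) ^ p / 2 * (v1' x t * dt v2' x t + dt v1' x t * v2' x t)) x t"
      using entry_x[of \<rho>' \<i> 2 2] \<rho>'_eq by (simp add: L_def lax_t_entries[OF p])
    moreover have "has_dx (dt v1') (\<rho>' x t * v1' x t) x t"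
      using entry_x[of "dt v1'" "-1" 1 2] dt_v'(1) by (simp add: L_def lax_t_entries[OF p])
    moreover have "(-1) ^ p * ((-1) ^ p * z) = z" for z :: complex
      using p by auto
    then have "has_dx (dt v2') (\<rho>' x t * v2' x t) x t"
      using entry_x[of "dt v2'" "- ((-1) ^ p)" 2 1] dt_v'(2) by (simp add: L_def lax_t_entries[OF p])
    ultimately show ?thesis
      using v'_t[OF xt] by (auto intro: differentiableI_vector)
  qed
  then show ?thesis
    by auto
qed

end
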